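(* For every integer $n\ge0$ let $$P_n=P_n(q)=\sum_{j\ge0}\sum_{k\ge0}q^{j(j-1)/2+k(k+1)/2}\begin{bmatrix} j\\ k\end{bmatrix}_{q}\begin{bmatrix} n-k\\ j\end{bmatrix}_{q}.$$ Then for every $n\ge1$, $$P_n=\sum_{j=-\infty}^\infty\Big[(-1)^jq^{2j^2}(1+q^j)\,T_1(n,4j+1;\sqrt q)+(-1)^jq^{2j^2+n-1}\,T_1(n-1,4j+1;\sqrt q)\Big],$$ and $P_0=1$, $P_1=2$, and $P_n=(1+q^{n-1})P_{n-1}+q^{n-1}P_{n-2}$ for $n\ge2$.
   Context: $q$ is an indeterminate with a formal square root $\sqrt q$. $(a;p)_n=\prod_{i=0}^{n-1}(1-ap^i)$. The Gaussian polynomial in base $p$ is $\begin{bmatrix} A\\ B\end{bmatrix}_{p}=\frac{(p;p)_A}{(p;p)_B(p;p)_{A-B}}$ if $0\le B\le A$, and $0$ otherwise. For integers $L\ge0$ and $A$, $$T_1(L,A;q)=\sum_{r=0}^L(-q)^r\begin{bmatrix} L\\ r\end{bmatrix}_{q^2}\begin{bmatrix} 2L-2r\\ L-A-r\end{bmatrix}_{q},$$ and $T_1(L,A;\sqrt q)$ is obtained by replacing $q$ by $\sqrt q$. All sums have only finitely many nonzero terms. *)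

theory Defs
  imports Main "HOL-Library.Groups_Big_Fun"
    "HOL-Computational_Algebra.Polynomial" "HOL-Computational_Algebra.Fraction_Field"
begin

definition qpoch :: "'a::comm_ring_1 \<Rightarrow> 'a \<Rightarrow> nat \<Rightarrow> 'a" where
  "qpoch a p n = (\<Prod>i<n. 1 - a * p ^ i)"

(* The quotient is meant literally; it is only used for bases p that are not roots of unity,
   so that the denominator is nonzero. *)
definition gauss :: "'a::field \<Rightarrow> int \<Rightarrow> int \<Rightarrow> 'a" where
  "gauss p A B =
     (if 0 \<le> B \<and> B \<le> A
      then qpoch p p (nat A) / (qpoch p p (nat B) * qpoch p p (nat (A - B)))
      else 0)"

definition T1 :: "nat \<Rightarrow> int \<Rightarrow> 'a::field \<Rightarrow> 'a" where
  "T1 L A q =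
     (\<Sum>r=0..L. (- q) ^ r * gauss (q ^ 2) (int L) (int r)
        * gauss q (2 * int L - 2 * int r) (int L - A - int r))"

(* Sum_any adds up the nonzero terms and is 0 if there are infinitely many of them.
   The lemmas below show that the latter never happens for the sums considered here. *)
definition P :: "'a::field \<Rightarrow> nat \<Rightarrow> 'a" where
  "P q n =
     Sum_any (\<lambda>j::nat. Sum_any (\<lambda>k::nat.
       q ^ (j * (j - 1) div 2 + k * (k + 1) div 2)
         * gauss q (int j) (int k) * gauss q (int n - int k) (int j)))"

(* The indeterminate of the field of rational functions over the rationals serves as the
   formal square root of q. *)
definition sqrt_q :: "rat poly fract" where
  "sqrt_q = Fract [:0, 1:] 1"

definition ind_q :: "rat poly fract" where
  "ind_q = sqrt_q ^ 2"

lemma finite_support_P_inner: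
  "finite {k. q ^ (j * (j - 1) div 2 + k * (k + 1) div 2)
     * gauss q (int j) (int k) * gauss q (int n - int k) (int j) \<noteq> (0::'a::field)}"
  by (rule finite_subset[of _ "{..j}"]) (auto simp: gauss_def split: if_splits)

lemma finite_support_P_outer:
  "finite {j. Sum_any (\<lambda>k. q ^ (j * (j - 1) div 2 + k * (k + 1) div 2)
     * gauss q (int j) (int k) * gauss q (int n - int k) (int j)) \<noteq> (0::'a::field)}"
proof (rule finite_subset)
  show "{j. Sum_any (\<lambda>k. q ^ (j * (j - 1) div 2 + k * (k + 1) div 2)
     * gauss q (int j) (int k) * gauss q (int n - int k) (int j)) \<noteq> (0::'a)} \<subseteq> {..n}"
  proof (intro subsetI, rule ccontr)
    fix j
    assume j: "j \<in> {j. Sum_any (\<lambda>k. q ^ (j * (j - 1) div 2 + k * (k + 1) div 2)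
      * gauss q (int j) (int k) * gauss q (int n - int k) (int j)) \<noteq> (0::'a)}"
    assume "j \<notin> {..n}"
    then have "gauss q (int n - int k) (int j) = 0" for k
      by (simp add: gauss_def)
    with j show False by simp
  qed
qed simp

lemma T1_eq_0: "\<bar>A\<bar> > int L \<Longrightarrow> T1 L A q = 0"
  unfolding T1_def by (rule sum.neutral) (auto simp: gauss_def)

lemma finite_support_bilateral:
  fixes f g :: "int \<Rightarrow> 'a::field"
  shows "finite {j. f j * T1 n (4 * j + 1) q + g j * T1 (n - 1) (4 * j + 1) q \<noteq> 0}"
proof (rule finite_subset)
  show "{j. f j * T1 n (4 * j + 1) q + g j * T1 (n - 1) (4 * j + 1) q \<noteq> 0}
    \<subseteq> {- int n - 1..int n}"
  proof (intro subsetI, rule ccontr)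
    fix j
    assume j: "j \<in> {j. f j * T1 n (4 * j + 1) q + g j * T1 (n - 1) (4 * j + 1) q \<noteq> 0}"
    assume "j \<notin> {- int n - 1..int n}"
    then have "\<bar>4 * j + 1\<bar> > int n" "\<bar>4 * j + 1\<bar> > int (n - 1)"
      by auto
    with j show False by (simp add: T1_eq_0)
  qed
qed simp

end

theory Submission
  imports Defs
begin

text \<open>
  The identity is proved by showing that both sides satisfy the same second-order recurrence. For
  the polynomials \<open>P\<close> it is \<open>P (n + 2) = P (n + 1) + q ^ (n + 1) * (P (n + 1) + P n)\<close>, and it
  follows from two applications of the q-Pascal rule (\<open>P_recurrence\<close>).

  For the other side let \<open>x\<close> be the square root of \<open>q\<close>. Besides \<open>T1\<close> one needs the q-trinomial
  coefficient \<open>T0\<close>, which has \<open>(- 1) ^ r\<close> where \<open>T1\<close> has \<open>(- x) ^ r\<close>. Three relations link them: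
  a recurrence in \<open>L\<close> (\<open>T1_Suc\<close>) and two relations at fixed \<open>L\<close> between values at \<open>A\<close> and
  \<open>A + 1\<close> (\<open>T1_T0_neighbour\<close>) and between values at \<open>A\<close> and \<open>A + 2\<close> (\<open>T0_T1_skip\<close>).

  Consider the bilateral sums \<open>\<alpha> n a b\<close> with summands
  \<open>(-1) powi j * x powi (4 * j ^ 2 + a * j) * T1 n (4 * j + b) x\<close>, and \<open>\<beta> n a b\<close> with \<open>T0\<close> in
  place of \<open>T1\<close>. Each relation above becomes a linear relation between such sums, and the
  substitutions \<open>j := j + 1\<close> and \<open>j := - j\<close> identify many of them up to a monomial. As a result all
  sums over \<open>T0\<close> can be eliminated, and the four quantities \<open>\<alpha> n 0 0\<close>, \<open>\<alpha> n 0 1\<close>, \<open>\<alpha> n 2 1\<close> and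
  \<open>\<alpha> n 2 0 + \<alpha> n 2 2\<close> satisfy a closed first-order system with coefficients \<open>1\<close>, \<open>2\<close>, \<open>q ^ n\<close>
  and \<open>2 * q ^ n\<close> (\<open>\<alpha>_0_0_Suc\<close>, \<open>\<alpha>_0_1_Suc\<close>, \<open>\<alpha>_2_1_Suc\<close>, \<open>\<alpha>_2_0_2_Suc\<close>). It implies that
  \<open>\<alpha> n 0 0 + \<alpha> n 2 1\<close> satisfies the recurrence of \<open>P\<close>, and for \<open>n \<ge> 1\<close> this quantity is the
  bilateral sum of the theorem.

  The argument uses of \<open>x\<close> only that it is nonzero and not a root of unity, so it is carried out for
  such an element of a field (of characteristic 0 for the bilateral sums) and applied to the
  indeterminate at the end.
\<close>

section \<open>Gaussian polynomials at a base that is not a root of unity\<close>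

locale non_root_of_unity =
  fixes p :: "'a::field"
  assumes nonzero: "p \<noteq> 0"
    and not_root: "0 < n \<Longrightarrow> p ^ n \<noteq> 1"
begin

lemma qpoch_nonzero: "qpoch p p n \<noteq> 0"
proof -
  have "1 - p * p ^ i \<noteq> 0" for i
    using not_root[of "Suc i"] by simp
  then show ?thesis
    by (simp add: qpoch_def)
qed

lemma gauss_symmetric: "gauss p A (A - B) = gauss p A B"
  by (auto simp: gauss_def mult.commute)

lemma gauss_absorb: "(1 - p powi B) * gauss p A B = (1 - p powi A) * gauss p (A - 1) (B - 1)"
proof (cases "1 \<le> B \<and> B \<le> A")
  case True
  define a b where "a = nat (A - 1)" and "b = nat (B - 1)"
  have AB: "A = int (Suc a)" "B = int (Suc b)" "b \<le> a"
    using True by (auto simp: a_def b_def)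
  have step: "qpoch p p (Suc n) = qpoch p p n * (1 - p ^ Suc n)" for n
    by (simp add: qpoch_def)
  have nat_diff: "nat (int (Suc a) - int (Suc b)) = a - b" "nat (int a - int b) = a - b"
    using AB by auto
  have "1 - p ^ Suc b \<noteq> 0"
    using not_root[of "Suc b"] by simp
  moreover have "gauss p A B = qpoch p p (Suc a) / (qpoch p p (Suc b) * qpoch p p (a - b))"
    using AB by (simp add: gauss_def nat_diff del: of_nat_Suc)
  moreover have "gauss p (A - 1) (B - 1) = qpoch p p a / (qpoch p p b * qpoch p p (a - b))"
    using AB by (simp add: gauss_def nat_diff)
  moreover have "p powi A = p ^ Suc a" "p powi B = p ^ Suc b"
    using AB by (simp_all only: power_int_of_nat)
  ultimately show ?thesis
    using qpoch_nonzero[of b] qpoch_nonzero[of "a - b"] unfolding step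
    by (simp del: power_Suc)
next
  case False
  then consider "B = 0" | "B < 0" | "A < B" by linarith
  then show ?thesis
    by cases (auto simp: gauss_def)
qed

lemma gauss_absorb_complement:
  "(1 - p powi (A - B)) * gauss p A B = (1 - p powi A) * gauss p (A - 1) B"
proof -
  have "gauss p (A - 1) (A - B - 1) = gauss p (A - 1) B"
    using gauss_symmetric[of "A - 1" B] by (simp add: algebra_simps)
  then show ?thesis
    using gauss_absorb[of "A - B" A] by (simp add: gauss_symmetric)
qed

text \<open>
  Multiplied by \<open>1 - p powi A\<close>, this is the sum of the two absorption rules. The recursion fails
  only at the apex \<open>A = B = 0\<close> of the triangle.
\<close>
lemma gauss_pascal:
  assumes "A \<noteq> 0 \<or> B \<noteq> 0"
  shows "gauss p A B = gauss p (A - 1) B + p powi (A - B) * gauss p (A - 1) (B - 1)"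
proof (cases "0 < A")
  case True
  then have "p powi A \<noteq> 1"
    using not_root[of "nat A"] by (simp add: power_int_def)
  moreover have "p powi (A - B) * p powi B = p powi A"
    using nonzero by (simp add: power_int_diff)
  then have "(1 - p powi A) * gauss p A B
      = (1 - p powi (A - B)) * gauss p A B + p powi (A - B) * ((1 - p powi B) * gauss p A B)"
    by (simp add: algebra_simps)
  then have "(1 - p powi A) * gauss p A B
      = (1 - p powi A) * (gauss p (A - 1) B + p powi (A - B) * gauss p (A - 1) (B - 1))"
    unfolding gauss_absorb gauss_absorb_complement by (simp add: algebra_simps)
  ultimately show ?thesis by simp
next
  case False
  then show ?thesis
    using assms by (auto simp: gauss_def)
qed

lemma gauss_pascal':
  assumes "A \<noteq> 0 \<or> A \<noteq> B"
  shows "gauss p A B = gauss p (A - 1) (B - 1) + p powi B * gauss p (A - 1) B"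
proof -
  have "gauss p (A - 1) (A - B) = gauss p (A - 1) (B - 1)"
    using gauss_symmetric[of "A - 1" "B - 1"] by (simp add: algebra_simps)
  moreover have "gauss p (A - 1) (A - B - 1) = gauss p (A - 1) B"
    using gauss_symmetric[of "A - 1" B] by (simp add: algebra_simps)
  ultimately show ?thesis
    using gauss_pascal[of A "A - B"] assms by (simp add: gauss_symmetric)
qed

end

section \<open>The recurrence of the polynomials\<close>

lemma P_double_sum:
  assumes "n \<le> N" "n \<le> K"
  shows "P q n = (\<Sum>j\<le>N. \<Sum>k\<le>K. q ^ (j * (j - 1) div 2 + k * (k + 1) div 2)
                     * gauss q (int j) (int k) * gauss q (int n - int k) (int j))"
    (is "_ = (\<Sum>j\<le>N. \<Sum>k\<le>K. ?t j k)")
proof -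
  have inner: "Sum_any (\<lambda>k. ?t j k) = (\<Sum>k\<le>K. ?t j k)" for j
    by (rule Sum_any.expand_superset) (use assms in \<open>auto simp: gauss_def split: if_splits\<close>)
  have "P q n = Sum_any (\<lambda>j. \<Sum>k\<le>K. ?t j k)"
    unfolding P_def inner ..
  also have "\<dots> = (\<Sum>j\<le>N. \<Sum>k\<le>K. ?t j k)"
  proof (rule Sum_any.expand_superset)
    show "{j. (\<Sum>k\<le>K. ?t j k) \<noteq> 0} \<subseteq> {..N}"
    proof (intro subsetI, rule ccontr)
      fix j assume j: "j \<in> {j. (\<Sum>k\<le>K. ?t j k) \<noteq> 0}" "j \<notin> {..N}"
      then have "gauss q (int n - int k) (int j) = 0" for k
        using assms by (simp add: gauss_def)
      then have "(\<Sum>k\<le>K. ?t j k) = 0"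
        by (simp only: mult_zero_right sum.neutral_const)
      with j(1) show False by simp
    qed
  qed simp
  finally show ?thesis .
qed

lemma triangle_Suc: "Suc k * (Suc k - 1) div 2 = k * (k - 1) div 2 + k"
proof -
  have "Suc k * (Suc k - 1) = k * (k - 1) + k * 2"
    by (cases k) auto
  then show ?thesis by simp
qed

context non_root_of_unity
begin

lemma P_0: "P p 0 = 1"
  by (subst P_double_sum[of 0 0 0]) (auto simp: gauss_def qpoch_def)

lemma P_1: "P p 1 = 2"
proof -
  have "1 - p \<noteq> 0" using not_root[of 1] by simp
  then show ?thesis
    by (subst P_double_sum[of 1 1 1]) (auto simp: gauss_def qpoch_def)
qed

text \<open>
  One step of the q-Pascal rule on the second Gaussian polynomial, followed by the shift of \<open>j\<close>,
  turns \<open>P (n + 2) - P (n + 1)\<close> into \<open>q ^ (n + 1)\<close> times the same double sum with \<open>j + 1\<close> on top of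
  the first Gaussian polynomial and the weight \<open>k * (k - 1) div 2\<close>. The other q-Pascal rule on that
  first polynomial splits it into \<open>P (n + 1)\<close> and, after the shift of \<open>k\<close>, \<open>P n\<close>.
\<close>
lemma P_recurrence:
  "P p (Suc (Suc n)) = P p (Suc n) + p ^ Suc n * (P p (Suc n) + P p n)"
proof -
  define c where "c k = k * (k - 1) div 2" for k :: nat
  have c_Suc: "c (Suc k) = c k + k" for k
    unfolding c_def by (rule triangle_Suc)
  have c_Suc': "k * (k + 1) div 2 = c k + k" for k :: nat
    using c_Suc[of k] by (simp add: c_def mult.commute)
  define N where "N = Suc (Suc n)"
  define w where "w j k = p ^ (c j + (c k + k)) * gauss p (int j) (int k)" for j k
  define g where "g m k j = gauss p (int m - int k) (int j)" for m k j :: nat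
  have P_eq: "P p m = (\<Sum>j\<le>J. \<Sum>k\<le>K. w j k * g m k j)" if "m \<le> J" "m \<le> K" for m J K
    by (subst P_double_sum[OF that]) (simp only: w_def g_def c_Suc' c_def)
  define h where "h j k = p powi (int N - int k - int j) * gauss p (int (Suc n) - int k) (int j - 1)"
    for j k
  \<comment> \<open>The q-Pascal rule fails at the apex, where \<open>k = n + 2 > 0 = j\<close>; there the weight vanishes.\<close>
  have step1: "w j k * g N k j = w j k * g (Suc n) k j + w j k * h j k" for j k
  proof (cases "k \<le> j")
    case True
    have "int N - int k \<noteq> 0 \<or> int j \<noteq> 0"
      using True by (auto simp: N_def)
    then show ?thesis
      using gauss_pascal[of "int N - int k" "int j"]
      by (simp add: g_def h_def N_def algebra_simps)
  next
    case False
    then have "w j k = 0" by (simp add: w_def gauss_def)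
    then show ?thesis by simp
  qed
  define v where "v j k = p ^ (c j + c k) * gauss p (int j) (int k - 1)" for j k
  have step2: "w (Suc j) k * h (Suc j) k = p ^ Suc n * (w j k * g (Suc n) k j + v j k * g (Suc n) k j)"
    for j k
  proof -
    have e: "p ^ (c (Suc j) + (c k + k)) * p powi (int N - int k - int (Suc j))
        = p ^ Suc n * p ^ (c j + c k)"
    proof -
      have "p ^ (c (Suc j) + (c k + k)) * p powi (int N - int k - int (Suc j))
        = p powi (int (c (Suc j) + (c k + k)) + (int N - int k - int (Suc j)))"
        using nonzero by (subst power_int_add) (simp_all flip: power_int_of_nat)
      also have "int (c (Suc j) + (c k + k)) + (int N - int k - int (Suc j)) = int (Suc n + (c j + c k))"
        by (simp add: c_Suc N_def)
      finally show ?thesis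
        by (simp only: power_int_of_nat power_add)
    qed
    have pas: "gauss p (int (Suc j)) (int k)
        = gauss p (int j) (int k - 1) + p ^ k * gauss p (int j) (int k)"
      using gauss_pascal'[of "int (Suc j)" "int k"] by simp
    have "w (Suc j) k * h (Suc j) k = (p ^ (c (Suc j) + (c k + k)) * p powi (int N - int k - int (Suc j)))
        * gauss p (int (Suc j)) (int k) * g (Suc n) k j"
      by (simp add: w_def h_def g_def)
    then show ?thesis
      unfolding e pas by (simp add: w_def v_def algebra_simps power_add)
  qed
  have step3: "(\<Sum>k\<le>N. v j k * g (Suc n) k j) = (\<Sum>k\<le>Suc n. w j k * g n k j)" for j
    unfolding N_def
    by (subst sum.atMost_Suc_shift) (simp add: v_def gauss_def[of _ _ "- 1"] w_def g_def c_Suc)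
  have "P p N = P p (Suc n) + (\<Sum>j\<le>N. \<Sum>k\<le>N. w j k * h j k)"
    by (simp add: P_eq[of _ N N] N_def step1[unfolded N_def] sum.distrib)
  also have "(\<Sum>j\<le>N. \<Sum>k\<le>N. w j k * h j k) = (\<Sum>j\<le>Suc n. \<Sum>k\<le>N. w (Suc j) k * h (Suc j) k)"
    unfolding N_def by (subst sum.atMost_Suc_shift) (simp add: h_def gauss_def)
  also have "\<dots> = p ^ Suc n * (P p (Suc n) + (\<Sum>j\<le>Suc n. \<Sum>k\<le>N. v j k * g (Suc n) k j))"
    by (simp add: step2 P_eq[of "Suc n" "Suc n" N] N_def sum.distrib sum_distrib_left distrib_left)
  also have "(\<Sum>j\<le>Suc n. \<Sum>k\<le>N. v j k * g (Suc n) k j) = P p n"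
    by (simp only: step3 P_eq[of n "Suc n" "Suc n"])
  finally show ?thesis
    by (simp add: N_def)
qed

end

section \<open>Relations between the two q-trinomial coefficients\<close>

context non_root_of_unity
begin

text \<open>
  A relation between q-trinomial coefficients at \<open>L + 1\<close> and at \<open>L\<close> can be compared summand by
  summand once every outer Gaussian polynomial has the upper index \<open>L\<close>.
  This rule and the next two do so for an arbitrary inner factor \<open>f\<close>.
\<close>
lemma gauss_sum_pascal:
  "(\<Sum>r\<le>Suc L. y ^ r * gauss p (int (Suc L)) (int r) * f (Suc L - r))
   = (\<Sum>r\<le>L. y ^ r * gauss p (int L) (int r) * (f (Suc (L - r)) + y * p ^ (L - r) * f (L - r)))"
proof -
  define h where "h r = y ^ r * (p powi (int (Suc L) - int r) * gauss p (int L) (int r - 1)) * f (Suc L - r)" for r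
  have split: "y ^ r * gauss p (int (Suc L)) (int r) * f (Suc L - r)
      = y ^ r * gauss p (int L) (int r) * f (Suc L - r) + h r" for r
    using gauss_pascal[of "int (Suc L)" "int r"] by (simp add: h_def algebra_simps)
  have "(\<Sum>r\<le>Suc L. y ^ r * gauss p (int L) (int r) * f (Suc L - r))
      = (\<Sum>r\<le>L. y ^ r * gauss p (int L) (int r) * f (Suc (L - r)))"
    by (simp add: gauss_def[of _ "int L" "1 + int L"] Suc_diff_le)
  moreover have "(\<Sum>r\<le>Suc L. h r)
      = (\<Sum>r\<le>L. y ^ r * gauss p (int L) (int r) * (y * p ^ (L - r) * f (L - r)))"
  proof -
    have "h (Suc r) = y ^ r * gauss p (int L) (int r) * (y * p ^ (L - r) * f (L - r))" if "r \<le> L" for r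
    proof -
      have "int (Suc L) - int (Suc r) = int (L - r)" "int (Suc r) - 1 = int r"
        using that by simp_all
      then show ?thesis
        by (simp only: h_def power_int_of_nat diff_Suc_Suc power_Suc ac_simps)
    qed
    moreover have "h 0 = 0" by (simp add: h_def gauss_def)
    ultimately show ?thesis
      by (subst sum.atMost_Suc_shift) simp
  qed
  ultimately show ?thesis
    by (simp only: split sum.distrib distrib_left)
qed

lemma gauss_sum_absorb:
  "(\<Sum>r\<le>Suc L. y ^ r * gauss p (int (Suc L)) (int r) * ((1 - p ^ r) * f (Suc L - r)))
   = (1 - p ^ Suc L) * y * (\<Sum>r\<le>L. y ^ r * gauss p (int L) (int r) * f (L - r))"
proof -
  have "gauss p (int (Suc L)) (int (Suc r)) * (1 - p ^ Suc r) = (1 - p ^ Suc L) * gauss p (int L) (int r)"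
    for r
    using gauss_absorb[of "int (Suc r)" "int (Suc L)"]
    by (simp only: power_int_of_nat) (simp add: mult.commute)
  then have eq: "y ^ Suc r * gauss p (int (Suc L)) (int (Suc r)) * ((1 - p ^ Suc r) * f (Suc L - Suc r))
      = (1 - p ^ Suc L) * y * (y ^ r * gauss p (int L) (int r) * f (L - r))" for r
    by (simp add: ac_simps)
  show ?thesis
    by (subst sum.atMost_Suc_shift)
       (simp only: eq sum_distrib_left power_0 diff_self mult_zero_left mult_zero_right add_0_left)
qed

lemma gauss_sum_absorb_complement:
  "(\<Sum>r\<le>Suc L. y ^ r * gauss p (int (Suc L)) (int r) * ((1 - p ^ (Suc L - r)) * f (Suc L - r)))
   = (1 - p ^ Suc L) * (\<Sum>r\<le>L. y ^ r * gauss p (int L) (int r) * f (Suc (L - r)))"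
proof -
  have "gauss p (int (Suc L)) (int r) * (1 - p ^ (Suc L - r)) = (1 - p ^ Suc L) * gauss p (int L) (int r)"
    if "r \<le> L" for r
  proof -
    have "int (Suc L) - int r = int (Suc L - r)" using that by simp
    then show ?thesis
      using gauss_absorb_complement[of "int (Suc L)" "int r"]
      by (simp only: power_int_of_nat) (simp add: mult.commute)
  qed
  then have eq: "y ^ r * gauss p (int (Suc L)) (int r) * ((1 - p ^ (Suc L - r)) * f (Suc L - r))
      = (1 - p ^ Suc L) * (y ^ r * gauss p (int L) (int r) * f (Suc (L - r)))" if "r \<le> L" for r
    using that by (simp add: ac_simps Suc_diff_le)
  have "(\<Sum>r\<le>L. y ^ r * gauss p (int (Suc L)) (int r) * ((1 - p ^ (Suc L - r)) * f (Suc L - r)))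
      = (\<Sum>r\<le>L. (1 - p ^ Suc L) * (y ^ r * gauss p (int L) (int r) * f (Suc (L - r))))"
    by (rule sum.cong) (simp_all only: eq atMost_iff)
  then show ?thesis
    by (simp only: sum.atMost_Suc sum_distrib_left diff_self_eq_0 power_0 diff_self
        mult_zero_left mult_zero_right add_0_right)
qed

end

text \<open>
  The companion of \<open>T1\<close> among the q-trinomial coefficients of Andrews and Baxter. The first-order
  recurrence of \<open>T1\<close> in \<open>L\<close> (\<open>T1_Suc\<close>) needs its values.
\<close>
definition T0 :: "nat \<Rightarrow> int \<Rightarrow> 'a::field \<Rightarrow> 'a" where
  "T0 L A q =
     (\<Sum>r=0..L. (- 1) ^ r * gauss (q ^ 2) (int L) (int r)
        * gauss q (2 * int L - 2 * int r) (int L - A - int r))"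

lemma T0_eq_0: "\<bar>A\<bar> > int L \<Longrightarrow> T0 L A q = 0"
  unfolding T0_def by (rule sum.neutral) (auto simp: gauss_def)

locale square_root = non_root_of_unity x for x :: "'a::field_char_0"
begin

sublocale sq: non_root_of_unity "x ^ 2"
proof
  show "x ^ 2 \<noteq> 0" using nonzero by simp
  show "(x ^ 2) ^ n \<noteq> 1" if "0 < n" for n
    using not_root[of "2 * n"] that by (simp add: power_mult)
qed

text \<open>
  The Gaussian polynomial in the summands of \<open>T0\<close> and \<open>T1\<close>, indexed by the distance from the
  centre of its row, so that it is even in that distance.
\<close>
definition central :: "nat \<Rightarrow> int \<Rightarrow> 'a" where
  "central M A = gauss x (2 * int M) (int M - A)"

lemma T1_central: "T1 L A x = (\<Sum>r\<le>L. (- x) ^ r * gauss (x ^ 2) (int L) (int r) * central (L - r) A)"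
  by (auto simp: T1_def central_def atLeast0AtMost of_nat_diff algebra_simps intro!: sum.cong)

lemma T0_central: "T0 L A x = (\<Sum>r\<le>L. (- 1) ^ r * gauss (x ^ 2) (int L) (int r) * central (L - r) A)"
  by (auto simp: T0_def central_def atLeast0AtMost of_nat_diff algebra_simps intro!: sum.cong)

lemma central_even: "central M (- A) = central M A"
  using gauss_symmetric[of "2 * int M" "int M - A"] by (simp add: central_def algebra_simps)

lemma T1_even: "T1 L (- A) x = T1 L A x" and T0_even: "T0 L (- A) x = T0 L A x"
  by (simp_all add: T1_central T0_central central_even)

lemma central_Suc:
  "central (Suc M) A = (1 + x ^ (2 * M + 1)) * central M A
     + x powi (int M + 1 + A) * central M (A + 1) + x powi (int M + 1 - A) * central M (A - 1)"
proof -
  have "central (Suc M) A = gauss x (2 * int M + 1) (int M + 1 - A)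
      + x powi (int M + 1 + A) * gauss x (2 * int M + 1) (int M - A)"
    using gauss_pascal[of "2 * int (Suc M)" "int (Suc M) - A"] by (simp add: central_def algebra_simps)
  moreover have "gauss x (2 * int M + 1) (int M + 1 - A) = central M A + x powi (int M + 1 - A) * central M (A - 1)"
    using gauss_pascal'[of "2 * int M + 1" "int M + 1 - A"] by (simp add: central_def algebra_simps)
  moreover have "gauss x (2 * int M + 1) (int M - A) = central M (A + 1) + x powi (int M - A) * central M A"
    using gauss_pascal'[of "2 * int M + 1" "int M - A"] by (simp add: central_def algebra_simps)
  moreover have "x powi (int M + 1 + A) * x powi (int M - A) = x ^ (2 * M + 1)"
  proof -
    have "x powi (int M + 1 + A) * x powi (int M - A) = x powi (int (2 * M + 1))"
      using nonzero by (simp add: algebra_simps flip: power_int_add)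
    then show ?thesis by (simp only: power_int_of_nat)
  qed
  ultimately show ?thesis by (simp add: algebra_simps)
qed

lemma central_neighbour: "(1 - x powi (int M - A)) * central M A = (1 - x powi (int M + A + 1)) * central M (A + 1)"
proof -
  let ?g = "(1 - x powi (2 * int M)) * gauss x (2 * int M - 1) (int M - A - 1)"
  have "(1 - x powi (int M - A)) * central M A = ?g"
    using gauss_absorb[of "int M - A" "2 * int M"] by (simp add: central_def)
  moreover have "(1 - x powi (int M + A + 1)) * central M (A + 1) = ?g"
    using gauss_absorb_complement[of "2 * int M" "int M - A - 1"] by (simp add: central_def algebra_simps)
  ultimately show ?thesis by simp
qed

text \<open>
  The factor \<open>x ^ r\<close> that distinguishes \<open>T1\<close> from \<open>T0\<close> is the one that converts a power of \<open>x\<close>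
  with exponent depending on \<open>L\<close> into one depending on \<open>L - r\<close>. This is why \<open>T1_Suc\<close> and
  \<open>T1_T0_neighbour\<close> hold summand by summand.
\<close>
lemma sign_powi:
  assumes "r \<le> L"
  shows "(- x) ^ r * x powi (int (L - r) + c) = (- 1) ^ r * x powi (int L + c)"
proof -
  have "x powi (int L + c) = x powi (int r + (int (L - r) + c))"
    using assms by (simp add: of_nat_diff)
  also have "\<dots> = x ^ r * x powi (int (L - r) + c)"
    using nonzero by (subst power_int_add) auto
  finally show ?thesis
    by (simp add: power_minus[of x])
qed

lemma T1_Suc:
  "T1 (Suc L) A x = T1 L A x + x powi (int L + 1 + A) * T0 L (A + 1) x
     + x powi (int L + 1 - A) * T0 L (A - 1) x"
proof -
  let ?b = "\<lambda>r. gauss (x ^ 2) (int L) (int r)"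
  have summand: "(- x) ^ r * ?b r * (central (Suc (L - r)) A + - x * (x ^ 2) ^ (L - r) * central (L - r) A)
      = (- x) ^ r * ?b r * central (L - r) A
        + x powi (int L + 1 + A) * ((- 1) ^ r * ?b r * central (L - r) (A + 1))
        + x powi (int L + 1 - A) * ((- 1) ^ r * ?b r * central (L - r) (A - 1))" if "r \<le> L" for r
  proof -
    have e: "x powi (int L + 1 + c) * ((- 1) ^ r * ?b r * y)
        = (- x) ^ r * ?b r * (x powi (int (L - r) + 1 + c) * y)" for c y
      using sign_powi[OF that, of "1 + c"] by (simp add: algebra_simps)
    have "x * (x ^ 2) ^ (L - r) = x ^ (2 * (L - r) + 1)"
      by (simp add: power_mult)
    then have "central (Suc (L - r)) A + - x * (x ^ 2) ^ (L - r) * central (L - r) A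
        = central (L - r) A + x powi (int (L - r) + 1 + A) * central (L - r) (A + 1)
          + x powi (int (L - r) + 1 - A) * central (L - r) (A - 1)"
      by (simp only: central_Suc mult_minus_left distrib_right) simp
    then show ?thesis
      by (simp only: e e[of "- A", unfolded add_uminus_conv_diff] flip: distrib_left)
  qed
  have "T1 (Suc L) A x = (\<Sum>r\<le>L. (- x) ^ r * ?b r * central (L - r) A
        + x powi (int L + 1 + A) * ((- 1) ^ r * ?b r * central (L - r) (A + 1))
        + x powi (int L + 1 - A) * ((- 1) ^ r * ?b r * central (L - r) (A - 1)))"
    unfolding T1_central sq.gauss_sum_pascal[where f = "\<lambda>M. central M A"]
    by (rule sum.cong) (simp_all only: summand atMost_iff)
  also have "\<dots> = T1 L A x + x powi (int L + 1 + A) * T0 L (A + 1) x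
      + x powi (int L + 1 - A) * T0 L (A - 1) x"
    by (simp only: T1_central T0_central sum.distrib sum_distrib_left)
  finally show ?thesis .
qed

lemma T1_T0_neighbour:
  "T1 L A x + x powi (int L + 1 + A) * T0 L (A + 1) x = T1 L (A + 1) x + x powi (int L - A) * T0 L A x"
proof -
  let ?b = "\<lambda>r. gauss (x ^ 2) (int L) (int r)"
  have summand: "(- x) ^ r * ?b r * central (L - r) A + x powi (int L + 1 + A) * ((- 1) ^ r * ?b r * central (L - r) (A + 1))
      = (- x) ^ r * ?b r * central (L - r) (A + 1) + x powi (int L - A) * ((- 1) ^ r * ?b r * central (L - r) A)"
    if "r \<le> L" for r
  proof -
    have "x powi (int L + 1 + A) * ((- 1) ^ r * ?b r * central (L - r) (A + 1))
        = (- x) ^ r * ?b r * (x powi (int (L - r) + 1 + A) * central (L - r) (A + 1))"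
      using sign_powi[OF that, of "1 + A"] by (simp add: algebra_simps)
    moreover have "x powi (int L - A) * ((- 1) ^ r * ?b r * central (L - r) A)
        = (- x) ^ r * ?b r * (x powi (int (L - r) - A) * central (L - r) A)"
      using sign_powi[OF that, of "- A"] by (simp add: algebra_simps)
    moreover have "central (L - r) A + x powi (int (L - r) + 1 + A) * central (L - r) (A + 1)
        = central (L - r) (A + 1) + x powi (int (L - r) - A) * central (L - r) A"
      using central_neighbour[of "L - r" A] by (simp add: algebra_simps)
    ultimately show ?thesis
      by (simp only: flip: distrib_left)
  qed
  have "(\<Sum>r\<le>L. (- x) ^ r * ?b r * central (L - r) A + x powi (int L + 1 + A) * ((- 1) ^ r * ?b r * central (L - r) (A + 1)))
      = (\<Sum>r\<le>L. (- x) ^ r * ?b r * central (L - r) (A + 1) + x powi (int L - A) * ((- 1) ^ r * ?b r * central (L - r) A))"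
    by (rule sum.cong) (simp_all only: summand atMost_iff)
  then show ?thesis
    by (simp only: T1_central T0_central sum.distrib sum_distrib_left)
qed

text \<open>
  The factor \<open>1 - x powi (2 * r) * x powi (M + A)\<close> with \<open>M = L - r\<close> is split into
  \<open>1 - x powi (M + A)\<close>, which is absorbed by the inner Gaussian polynomial and then by the outer one,
  and a multiple of \<open>1 - x powi (2 * r)\<close>, which is absorbed by the outer one. Both parts then have the
  upper index \<open>L - 1\<close> and combine by the q-Pascal rule.
\<close>
lemma T0_T1_lower:
  "T0 L A x - x powi (int L + A) * T1 L A x = (1 - (x ^ 2) ^ L) * T0 (L - 1) (A - 1) x"
proof (cases L)
  case 0
  then show ?thesis
    by (cases "A = 0") (auto simp: T0_def T1_def gauss_def qpoch_def)
next
  case (Suc K)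
  let ?b = "\<lambda>L r. gauss (x ^ 2) (int L) (int r)"
  have summand: "(- 1) ^ r * ?b L r * central (L - r) A - x powi (int L + A) * ((- x) ^ r * ?b L r * central (L - r) A)
      = (- 1) ^ r * ?b L r * ((1 - (x ^ 2) ^ (L - r)) * gauss x (2 * int (L - r) - 1) (int (L - r) - A))
      + (- 1) ^ r * ?b L r * ((1 - (x ^ 2) ^ r) * (x powi (int (L - r) + A) * central (L - r) A))"
    if "r \<le> L" for r
  proof -
    have absorb: "(1 - x powi (int (L - r) + A)) * central (L - r) A
        = (1 - (x ^ 2) ^ (L - r)) * gauss x (2 * int (L - r) - 1) (int (L - r) - A)"
      using gauss_absorb_complement[of "2 * int (L - r)" "int (L - r) - A"]
      by (simp add: central_def algebra_simps power_int_mult flip: power_mult)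
    have shift: "x powi (int L + A) * (- x) ^ r = (- 1) ^ r * (x ^ 2) ^ r * x powi (int (L - r) + A)"
    proof -
      have "x powi (int L + A) * (- x) ^ r = (- 1) ^ r * x powi (int L + A) * x ^ r"
        by (simp add: power_minus[of x])
      also have "\<dots> = (- x) ^ r * x powi (int (L - r) + A) * x ^ r"
        by (simp only: sign_powi[OF that])
      also have "\<dots> = (- 1) ^ r * (x ^ 2) ^ r * x powi (int (L - r) + A)"
        by (simp add: power_minus[of x] power2_eq_square power_mult_distrib)
      finally show ?thesis .
    qed
    have split: "(- 1) ^ r * b * g - (- 1) ^ r * (x ^ 2) ^ r * u * (b * g)
        = (- 1) ^ r * b * ((1 - u) * g) + (- 1) ^ r * b * ((1 - (x ^ 2) ^ r) * (u * g))" for b g u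
      by (simp add: algebra_simps)
    have "x powi (int L + A) * ((- x) ^ r * ?b L r * central (L - r) A)
        = (x powi (int L + A) * (- x) ^ r) * (?b L r * central (L - r) A)"
      by (simp only: mult.assoc)
    then show ?thesis
      by (simp only: shift split absorb)
  qed
  have factor: "c * u + c * (- 1) * v = c * (u - v)" for c u v :: 'a
    by (simp add: algebra_simps)
  have low: "gauss x (2 * int (Suc M) - 1) (int (Suc M) - A) - x powi (int M + A) * central M A = central M (A - 1)" for M
    using gauss_pascal[of "2 * int M + 1" "int M + 1 - A"] by (simp add: central_def algebra_simps)
  have "T0 L A x - x powi (int L + A) * T1 L A x
      = (\<Sum>r\<le>L. (- 1) ^ r * ?b L r * central (L - r) A - x powi (int L + A) * ((- x) ^ r * ?b L r * central (L - r) A))"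
    by (simp only: T0_central T1_central sum_subtractf sum_distrib_left)
  also have "\<dots> = (\<Sum>r\<le>L. (- 1) ^ r * ?b L r * ((1 - (x ^ 2) ^ (L - r)) * gauss x (2 * int (L - r) - 1) (int (L - r) - A)))
      + (\<Sum>r\<le>L. (- 1) ^ r * ?b L r * ((1 - (x ^ 2) ^ r) * (x powi (int (L - r) + A) * central (L - r) A)))"
    unfolding sum.distrib[symmetric] by (rule sum.cong) (simp_all only: summand atMost_iff)
  also have "\<dots> = (1 - (x ^ 2) ^ L) *
      ((\<Sum>r\<le>K. (- 1) ^ r * ?b K r * gauss x (2 * int (Suc (K - r)) - 1) (int (Suc (K - r)) - A))
       - (\<Sum>r\<le>K. (- 1) ^ r * ?b K r * (x powi (int (K - r) + A) * central (K - r) A)))"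
    unfolding Suc
    by (subst sq.gauss_sum_absorb_complement[where f = "\<lambda>M. gauss x (2 * int M - 1) (int M - A)"],
        subst sq.gauss_sum_absorb[where f = "\<lambda>M. x powi (int M + A) * central M A"])
       (rule factor)
  also have "\<dots> = (1 - (x ^ 2) ^ L) * T0 K (A - 1) x"
    by (simp only: T0_central flip: sum_subtractf right_diff_distrib low)
  finally show ?thesis by (simp add: Suc)
qed

text \<open>
  The right-hand side of the previous relation is the same for \<open>A + 2\<close> and, by evenness, for \<open>- A\<close>;
  eliminating it leaves a relation at a single value of \<open>L\<close>.
\<close>
lemma T0_T1_skip:
  "T0 L (A + 2) x + x powi (int L - A) * T1 L A x
   = T0 L A x + x powi (int L + 2 + A) * T1 L (A + 2) x"
proof -
  let ?t = "(1 - (x ^ 2) ^ L) * T0 (L - 1) (A + 1) x"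
  have "T0 L (A + 2) x - x powi (int L + 2 + A) * T1 L (A + 2) x = ?t"
    using T0_T1_lower[of L "A + 2"] by (simp add: algebra_simps)
  moreover have "T0 L A x - x powi (int L - A) * T1 L A x = ?t"
    using T0_T1_lower[of L "- A"] T0_even[of L A] T1_even[of L A] T0_even[of "L - 1" "A + 1"]
    by (simp add: algebra_simps)
  ultimately have "T0 L (A + 2) x - x powi (int L + 2 + A) * T1 L (A + 2) x
      = T0 L A x - x powi (int L - A) * T1 L A x" by simp
  then show ?thesis by (simp add: algebra_simps)
qed

end

section \<open>Alternating bilateral sums\<close>

context square_root
begin

text \<open>
  The exponent \<open>4 * j ^ 2\<close> is \<open>2 * j ^ 2\<close> in the variable \<open>q = x ^ 2\<close>. A factor \<open>x powi A\<close> at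
  \<open>A = 4 * j + b\<close> amounts to \<open>a := a + 4\<close> and a translation of \<open>A\<close> to a change of \<open>b\<close>, so that
  every relation between q-trinomial coefficients becomes one between sums with different \<open>a\<close> and \<open>b\<close>.
\<close>
definition bilateral :: "int \<Rightarrow> int \<Rightarrow> (int \<Rightarrow> 'a) \<Rightarrow> 'a" where
  "bilateral a b F = Sum_any (\<lambda>j::int. (- 1) powi j * x powi (4 * j ^ 2 + a * j) * F (4 * j + b))"

lemma finite_bilateral:
  assumes "finite {A. F A \<noteq> 0}"
  shows "finite {j::int. c j * F (4 * j + b) \<noteq> (0::'a)}"
proof (rule finite_subset)
  show "finite ((\<lambda>j. 4 * j + b) -` {A. F A \<noteq> 0})"
    using assms by (rule finite_vimageI) (auto simp: inj_def)
qed auto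

lemma bilateral_add:
  assumes "finite {A. F A \<noteq> 0}" "finite {A. H A \<noteq> 0}"
  shows "bilateral a b (\<lambda>A. F A + H A) = bilateral a b F + bilateral a b H"
  unfolding bilateral_def distrib_left
  using assms by (intro Sum_any.distrib finite_bilateral)

lemma finite_shifted:
  assumes "finite {A. F A \<noteq> 0}"
  shows "finite {A::int. c A * F (A + d) \<noteq> (0::'a)}"
proof (rule finite_subset)
  show "finite ((\<lambda>A. A + d) -` {A. F A \<noteq> 0})"
    using assms by (rule finite_vimageI) (auto simp: inj_def)
qed auto

lemma bilateral_weight:
  assumes "finite {A. F A \<noteq> 0}"
  shows "bilateral a b (\<lambda>A. x powi (k + c * A) * F (A + d)) = x powi (k + c * b) * bilateral (a + 4 * c) (b + d) F"
proof -
  have "x powi (4 * j ^ 2 + a * j) * x powi (k + c * (4 * j + b))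
      = x powi (k + c * b) * x powi (4 * j ^ 2 + (a + 4 * c) * j)" for j
    using nonzero by (simp add: algebra_simps flip: power_int_add)
  then have "(- 1) powi j * (x powi (4 * j ^ 2 + a * j) * x powi (k + c * (4 * j + b))) * F (4 * j + b + d)
      = (- 1) powi j * (x powi (k + c * b) * x powi (4 * j ^ 2 + (a + 4 * c) * j)) * F (4 * j + (b + d))" for j
    by (simp only: add.assoc)
  then have "(- 1) powi j * x powi (4 * j ^ 2 + a * j) * (x powi (k + c * (4 * j + b)) * F (4 * j + b + d))
      = x powi (k + c * b) * ((- 1) powi j * x powi (4 * j ^ 2 + (a + 4 * c) * j) * F (4 * j + (b + d)))" for j
    by (simp only: mult.assoc mult.left_commute[of "(- 1) powi j" "x powi (k + c * b)"])
  then show ?thesis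
    unfolding bilateral_def by (simp only: Sum_any_right_distrib[OF finite_bilateral[OF assms]])
qed

text \<open>
  The substitution \<open>j := j + 1\<close>. Together with the substitution \<open>j := - j\<close> of the lemma
  \<open>bilateral_reflect\<close> it keeps the set of sums that occur below finite.
\<close>
lemma bilateral_shift:
  assumes "finite {A. F A \<noteq> 0}"
  shows "bilateral a b F = - (x powi (4 + a)) * bilateral (a + 8) (b + 4) F"
proof -
  have "x powi (4 * (j + 1) ^ 2 + a * (j + 1)) = x powi (4 + a) * x powi (4 * j ^ 2 + (a + 8) * j)" for j
    using nonzero by (simp add: algebra_simps power2_eq_square flip: power_int_add)
  moreover have "(- 1) powi (j + 1) = - ((- 1) powi j :: 'a)" for j
    by (simp add: power_int_add)
  moreover have "4 * (j + 1) + b = 4 * j + (b + 4)" for j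
    by simp
  ultimately have summand: "(- 1) powi (j + 1) * x powi (4 * (j + 1) ^ 2 + a * (j + 1)) * F (4 * (j + 1) + b)
      = - (x powi (4 + a)) * ((- 1) powi j * x powi (4 * j ^ 2 + (a + 8) * j) * F (4 * j + (b + 4)))" for j
    by (simp only:) (simp add: ac_simps)
  have "bij (\<lambda>j::int. j + 1)"
    by (rule bijI') (auto intro: exI[of _ "_ - 1"])
  then have "bilateral a b F = Sum_any (\<lambda>j. (- 1) powi (j + 1) * x powi (4 * (j + 1) ^ 2 + a * (j + 1)) * F (4 * (j + 1) + b))"
    unfolding bilateral_def by (rule Sum_any.reindex_cong) (simp add: o_def)
  also have "\<dots> = - (x powi (4 + a)) * bilateral (a + 8) (b + 4) F"
    unfolding bilateral_def summand by (rule Sum_any_right_distrib[OF finite_bilateral[OF assms], symmetric])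
  finally show ?thesis .
qed

lemma bilateral_reflect:
  assumes "\<And>A. F (- A) = F A"
  shows "bilateral a b F = bilateral (- a) (- b) F"
proof -
  have "bij (uminus :: int \<Rightarrow> int)"
    by (rule bijI') (auto intro: exI[of _ "- _"])
  moreover have "F (b - 4 * j) = F (4 * j - b)" for j
    using assms[of "4 * j - b"] by simp
  moreover have "(- 1) powi (- j) = ((- 1) powi j :: 'a)" for j
    by (simp add: power_int_minus flip: power_int_inverse)
  ultimately show ?thesis
    unfolding bilateral_def by (intro Sum_any.reindex_cong[of uminus]) (auto simp: o_def fun_eq_iff)
qed

abbreviation \<alpha> :: "nat \<Rightarrow> int \<Rightarrow> int \<Rightarrow> 'a" where
  "\<alpha> n a b \<equiv> bilateral a b (\<lambda>A. T1 n A x)"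

abbreviation \<beta> :: "nat \<Rightarrow> int \<Rightarrow> int \<Rightarrow> 'a" where
  "\<beta> n a b \<equiv> bilateral a b (\<lambda>A. T0 n A x)"

lemma finite_T1: "finite {A. T1 n A x \<noteq> 0}"
  by (rule finite_subset[of _ "{- int n..int n}"]) (use T1_eq_0[of n _ x] in force)+

lemma finite_T0: "finite {A. T0 n A x \<noteq> 0}"
  by (rule finite_subset[of _ "{- int n..int n}"]) (use T0_eq_0[of n _ x] in force)+

lemmas finite_supports = finite_T0 finite_T1
  finite_shifted[OF finite_T0] finite_shifted[OF finite_T1]
  finite_shifted[OF finite_T0, where c = "\<lambda>_. 1", unfolded mult_1_left]
  finite_shifted[OF finite_T1, where c = "\<lambda>_. 1", unfolded mult_1_left]
  finite_shifted[OF finite_T0, where d = 0, unfolded add_0_right]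
  finite_shifted[OF finite_T1, where d = 0, unfolded add_0_right]
  finite_shifted[OF finite_T0, where d = "- 1", unfolded add_uminus_conv_diff]

lemma finite_add:
  assumes "finite {A. F A \<noteq> 0}" "finite {A. H A \<noteq> 0}"
  shows "finite {A. F A + H A \<noteq> (0::'a)}"
  by (rule finite_subset[of _ "{A. F A \<noteq> 0} \<union> {A. H A \<noteq> 0}"]) (use assms in auto)

lemma bilateral_translate: "bilateral a b (\<lambda>A. F (A + d)) = bilateral a (b + d) F"
  by (simp add: bilateral_def add.assoc)

lemma bilateral_up:
  assumes "finite {A. F A \<noteq> 0}"
  shows "bilateral a b (\<lambda>A. x powi (k + A) * F (A + d)) = x powi (k + b) * bilateral (a + 4) (b + d) F"
  using bilateral_weight[OF assms, of a b k 1 d] by simp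

lemma bilateral_down:
  assumes "finite {A. F A \<noteq> 0}"
  shows "bilateral a b (\<lambda>A. x powi (k - A) * F (A - d)) = x powi (k - b) * bilateral (a - 4) (b - d) F"
  using bilateral_weight[OF assms, of a b k "- 1" "- d"] by simp

lemma bilateral_down0:
  assumes "finite {A. F A \<noteq> 0}"
  shows "bilateral a b (\<lambda>A. x powi (k - A) * F A) = x powi (k - b) * bilateral (a - 4) b F"
  using bilateral_down[OF assms, of a b k 0] by simp

lemma \<alpha>_Suc:
  "\<alpha> (Suc n) a b = \<alpha> n a b + x powi (int n + 1 + b) * \<beta> n (a + 4) (b + 1)
     + x powi (int n + 1 - b) * \<beta> n (a - 4) (b - 1)"
  unfolding T1_Suc
  by (simp only: bilateral_add finite_add finite_supports bilateral_up[OF finite_T0] bilateral_down[OF finite_T0])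

lemma \<alpha>_\<beta>_neighbour:
  "\<alpha> n a b + x powi (int n + 1 + b) * \<beta> n (a + 4) (b + 1)
   = \<alpha> n a (b + 1) + x powi (int n - b) * \<beta> n (a - 4) b"
proof -
  have "bilateral a b (\<lambda>A. T1 n A x + x powi (int n + 1 + A) * T0 n (A + 1) x)
      = bilateral a b (\<lambda>A. T1 n (A + 1) x + x powi (int n - A) * T0 n A x)"
    by (simp only: T1_T0_neighbour)
  then show ?thesis
    by (simp only: bilateral_add finite_supports bilateral_up[OF finite_T0] bilateral_down0[OF finite_T0]
        bilateral_translate[where F = "\<lambda>A. T1 n A x"])
qed

lemma \<beta>_\<alpha>_skip:
  "\<beta> n a (b + 2) + x powi (int n - b) * \<alpha> n (a - 4) b
   = \<beta> n a b + x powi (int n + 2 + b) * \<alpha> n (a + 4) (b + 2)"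
proof -
  have "bilateral a b (\<lambda>A. T0 n (A + 2) x + x powi (int n - A) * T1 n A x)
      = bilateral a b (\<lambda>A. T0 n A x + x powi (int n + 2 + A) * T1 n (A + 2) x)"
    by (simp only: T0_T1_skip)
  then show ?thesis
    by (simp only: bilateral_add finite_supports bilateral_up[OF finite_T1] bilateral_down0[OF finite_T1]
        bilateral_translate[where F = "\<lambda>A. T0 n A x"])
qed

lemmas \<alpha>_shift = bilateral_shift[OF finite_T1]
  and \<beta>_shift = bilateral_shift[OF finite_T0]
  and \<alpha>_reflect = bilateral_reflect[where F = "\<lambda>A. T1 n A x" for n, OF T1_even]
  and \<beta>_reflect = bilateral_reflect[where F = "\<lambda>A. T0 n A x" for n, OF T0_even]

lemma square_power: "(x ^ 2) ^ n = x ^ n * x ^ n"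
  by (simp add: power2_eq_square power_mult_distrib)

text \<open>
  Reflection and shift send \<open>\<beta> n 4 3\<close> to \<open>- \<beta> n 4 1\<close> and \<open>\<alpha> n 8 3\<close> to a multiple of
  \<open>\<alpha> n 0 1\<close>, so the skip relation contains only two sums, each of them twice.
\<close>
lemma \<beta>_4_1: "x * \<beta> n 4 1 = x ^ n * \<alpha> n 0 1"
proof -
  have skip: "\<beta> n 4 3 + x powi (int n - 1) * \<alpha> n 0 1 = \<beta> n 4 1 + x powi (int n + 3) * \<alpha> n 8 3"
    using \<beta>_\<alpha>_skip[of 4 1 n] by (simp add: add.commute)
  have "\<beta> n 4 3 = - \<beta> n 4 1"
    using \<beta>_shift[of "- 4" "- 1" n] \<beta>_reflect[of 4 1 n] by simp
  moreover have "x powi (int n + 3) * \<alpha> n 8 3 = - (x powi (int n - 1) * \<alpha> n 0 1)"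
  proof -
    have "x powi (int n + 3) = x powi (int n - 1) * x ^ 4"
      using nonzero power_int_add[of x "int n - 1" 4] by (simp add: add.commute)
    moreover have "\<alpha> n 0 1 = - (x ^ 4 * \<alpha> n 8 3)"
      using \<alpha>_shift[of 0 "- 1" n] \<alpha>_reflect[of 0 1 n] by simp
    ultimately show ?thesis by simp
  qed
  ultimately have "2 * \<beta> n 4 1 = 2 * (x powi (int n - 1) * \<alpha> n 0 1)"
    using skip by (simp add: algebra_simps)
  then have "\<beta> n 4 1 = x powi (int n - 1) * \<alpha> n 0 1" by simp
  then show ?thesis
    using nonzero by (simp add: power_int_diff)
qed

lemma \<beta>_4_2: "\<beta> n 4 2 = 0"
  using \<beta>_shift[of "- 4" "- 2" n] \<beta>_reflect[of 4 2 n] by simp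

lemma \<alpha>_0_0_Suc: "\<alpha> (Suc n) 0 0 = \<alpha> n 0 0 + 2 * (x ^ 2) ^ n * \<alpha> n 0 1"
proof -
  have "\<alpha> (Suc n) 0 0 = \<alpha> n 0 0 + 2 * x ^ n * (x * \<beta> n 4 1)"
    using \<alpha>_Suc[of 0 0 n] \<beta>_reflect[of 4 1 n] nonzero
    by (simp add: power_int_add algebra_simps)
  then show ?thesis
    unfolding \<beta>_4_1 by (simp add: square_power algebra_simps)
qed

lemma \<alpha>_0_1_Suc: "\<alpha> (Suc n) 0 1 = \<alpha> n 0 0 + (x ^ 2) ^ n * \<alpha> n 0 1"
proof -
  have "\<alpha> (Suc n) 0 1 = \<alpha> n 0 1 + x ^ n * \<beta> n (- 4) 0"
    using \<alpha>_Suc[of 0 1 n] \<beta>_4_2[of n] by simp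
  moreover have "\<alpha> n 0 0 + x ^ n * (x * \<beta> n 4 1) = \<alpha> n 0 1 + x ^ n * \<beta> n (- 4) 0"
    using \<alpha>_\<beta>_neighbour[of 0 0 n] nonzero by (simp add: power_int_add algebra_simps)
  ultimately show ?thesis
    unfolding \<beta>_4_1 by (simp add: square_power algebra_simps)
qed

lemma reflect_shift_2: "x ^ 2 * \<beta> n 6 b = - \<beta> n 2 (4 - b)" "x ^ 2 * \<alpha> n 6 b = - \<alpha> n 2 (4 - b)"
  "\<beta> n (- 2) b = \<beta> n 2 (- b)" "\<alpha> n (- 2) b = \<alpha> n 2 (- b)"
  using \<beta>_shift[of "- 6" "- b" n] \<beta>_reflect[of 6 b n] \<alpha>_shift[of "- 6" "- b" n] \<alpha>_reflect[of 6 b n]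
    \<beta>_reflect[of "- 2" b n] \<alpha>_reflect[of "- 2" b n] nonzero
  by (simp_all add: power_int_minus)

lemma \<beta>_2_0_2: "\<beta> n 2 0 - \<beta> n 2 2 = x ^ n * (\<alpha> n 2 0 + \<alpha> n 2 2)"
proof -
  have "x powi (int n + 2) * \<alpha> n 6 2 = - (x ^ n * \<alpha> n 2 2)"
    using reflect_shift_2(2)[of 2 n] nonzero by (simp add: power_int_add algebra_simps)
  then show ?thesis
    using \<beta>_\<alpha>_skip[of 2 0 n] reflect_shift_2(4)[of 0 n] by (simp add: algebra_simps)
qed

lemma \<alpha>_2_1_Suc: "\<alpha> (Suc n) 2 1 = \<alpha> n 2 1 + (x ^ 2) ^ n * (\<alpha> n 2 0 + \<alpha> n 2 2)"
proof -
  have "x powi (int n + 2) * \<beta> n 6 2 = - (x ^ n * \<beta> n 2 2)"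
    using reflect_shift_2(1)[of 2 n] nonzero by (simp add: power_int_add algebra_simps)
  then have "\<alpha> (Suc n) 2 1 = \<alpha> n 2 1 + x ^ n * (\<beta> n 2 0 - \<beta> n 2 2)"
    using \<alpha>_Suc[of 2 1 n] reflect_shift_2(3)[of 0 n] by (simp add: algebra_simps)
  then show ?thesis
    unfolding \<beta>_2_0_2 by (simp add: square_power algebra_simps)
qed

text \<open>
  The sums \<open>\<beta> n 2 1\<close> cancel between the two recurrences. The neighbour relations at \<open>b = 0\<close> and
  \<open>b = 1\<close> trade \<open>\<beta> n 2 (- 1) - \<beta> n 2 3\<close>, the difference that remains, for
  \<open>\<beta> n 2 0 - \<beta> n 2 2\<close> and sums of \<open>T1\<close>.
\<close>
lemma \<alpha>_2_0_2_Suc: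
  "\<alpha> (Suc n) 2 0 + \<alpha> (Suc n) 2 2 = 2 * \<alpha> n 2 1 + (x ^ 2) ^ n * (\<alpha> n 2 0 + \<alpha> n 2 2)"
proof -
  \<comment> \<open>Every exponent in the four relations is \<open>n\<close> or \<open>n - 1\<close> plus a fixed even number.\<close>
  define y where "y = x powi (int n - 1)"
  have y: "x powi (int n + 1) = y * x ^ 2" "x powi (2 + int n) = x ^ n * x ^ 2"
    "x powi (3 + int n) = y * x ^ 2 * x ^ 2"
    using nonzero
    by (simp_all add: y_def power_int_add power_int_diff power_numeral_reduce)
  have "\<alpha> (Suc n) 2 0 = \<alpha> n 2 0 - y * \<beta> n 2 3 + y * x ^ 2 * \<beta> n 2 1"
    using \<alpha>_Suc[of 2 0 n] reflect_shift_2(1)[of 1 n] reflect_shift_2(3)[of "- 1" n] by (simp add: y mult.assoc)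
  moreover have "x ^ 4 * \<beta> n 6 3 = - (x ^ 2 * \<beta> n 2 1)"
  proof -
    have "x ^ 4 * \<beta> n 6 3 = x ^ 2 * (x ^ 2 * \<beta> n 6 3)" by simp
    then show ?thesis by (simp only: reflect_shift_2) simp
  qed
  then have "\<alpha> (Suc n) 2 2 = \<alpha> n 2 2 - y * x ^ 2 * \<beta> n 2 1 + y * \<beta> n 2 (- 1)"
    using \<alpha>_Suc[of 2 2 n] reflect_shift_2(3)[of 1 n] by (simp add: y mult.assoc flip: y_def)
  moreover have "\<alpha> n 2 0 - y * \<beta> n 2 3 = \<alpha> n 2 1 + x ^ n * \<beta> n 2 0"
    using \<alpha>_\<beta>_neighbour[of 2 0 n] reflect_shift_2(1)[of 1 n] reflect_shift_2(3)[of 0 n] by (simp add: y mult.assoc)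
  moreover have "\<alpha> n 2 1 - x ^ n * \<beta> n 2 2 = \<alpha> n 2 2 + y * \<beta> n 2 (- 1)"
    using \<alpha>_\<beta>_neighbour[of 2 1 n] reflect_shift_2(1)[of 2 n] reflect_shift_2(3)[of 1 n] by (simp add: y mult.assoc flip: y_def)
  ultimately have "\<alpha> (Suc n) 2 0 + \<alpha> (Suc n) 2 2 = 2 * \<alpha> n 2 1 + x ^ n * (\<beta> n 2 0 - \<beta> n 2 2)"
    by (simp add: algebra_simps)
  then show ?thesis
    unfolding \<beta>_2_0_2 by (simp add: square_power algebra_simps)
qed

lemma T1_0: "T1 0 A x = (if A = 0 then 1 else 0)"
  by (auto simp: T1_def gauss_def qpoch_def)

lemma \<alpha>_0: "\<alpha> 0 a 0 = 1" "\<not> 4 dvd b \<Longrightarrow> \<alpha> 0 a b = 0"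
proof -
  have "\<alpha> 0 a 0 = Sum_any (\<lambda>j::int. if j = 0 then 1 else 0)"
    unfolding bilateral_def T1_0 by (rule Sum_any.cong) auto
  then show "\<alpha> 0 a 0 = 1" by simp
  assume "\<not> 4 dvd b"
  then have "4 * j + b \<noteq> 0" for j by presburger
  then show "\<alpha> 0 a b = 0" by (simp add: bilateral_def T1_0)
qed

text \<open>
  With \<open>X n\<close> for the right-hand side and \<open>Y n = 2 * \<alpha> n 0 1 + \<alpha> n 2 0 + \<alpha> n 2 2\<close>, the four
  recurrences add up to \<open>X (n + 1) = X n + q ^ n * Y n\<close> and \<open>Y (n + 1) = 2 * X n + q ^ n * Y n\<close>.
  Elimination of \<open>Y\<close> gives the recurrence of \<open>P\<close>.
\<close>
lemma P_eq_\<alpha>: "P (x ^ 2) n = \<alpha> n 2 1 + \<alpha> n 0 0"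
proof (induction n rule: induct_nat_012)
  case 0
  then show ?case by (simp add: sq.P_0 \<alpha>_0)
next
  case 1
  then show ?case using sq.P_1 \<alpha>_2_1_Suc[of 0] \<alpha>_0_0_Suc[of 0] by (simp add: \<alpha>_0)
next
  case (ge2 n)
  define q where "q = x ^ 2"
  show ?case
    unfolding sq.P_recurrence ge2
    unfolding \<alpha>_2_1_Suc[of "Suc n"] \<alpha>_0_0_Suc[of "Suc n"] \<alpha>_0_1_Suc[of n] \<alpha>_2_0_2_Suc[of n]
    unfolding \<alpha>_2_1_Suc[of n] \<alpha>_0_0_Suc[of n]
    by (fold q_def) (simp add: algebra_simps)
qed

text \<open>
  The bilateral sum is \<open>\<alpha> (n + 1) 0 1 + \<alpha> (n + 1) 2 1 + q ^ n * \<alpha> n 0 1\<close>, in which the first and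
  the third term make up \<open>\<alpha> (n + 1) 0 0\<close>.
\<close>
lemma P_eq_Sum_any:
  "P (x ^ 2) (Suc n) = Sum_any (\<lambda>j::int.
      (- 1) powi j * (x ^ 2) powi (2 * j ^ 2) * (1 + (x ^ 2) powi j) * T1 (Suc n) (4 * j + 1) x
      + (- 1) powi j * (x ^ 2) powi (2 * j ^ 2 + int n) * T1 n (4 * j + 1) x)"
proof -
  define f where "f a m j = (- 1) powi j * x powi (4 * j ^ 2 + a * j) * T1 m (4 * j + 1) x"
    for a m and j :: int
  have \<alpha>_eq: "\<alpha> m a 1 = Sum_any (f a m)" for m a
    by (simp add: bilateral_def f_def)
  have fin: "finite {j. f a m j \<noteq> 0}" for a m
    unfolding f_def by (rule finite_bilateral[OF finite_T1])
  have fin': "finite {j. (x ^ 2) ^ n * f a m j \<noteq> 0}" for a m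
    by (rule finite_subset[OF _ fin[of a m]]) auto
  have "P (x ^ 2) (Suc n) = \<alpha> (Suc n) 0 1 + \<alpha> (Suc n) 2 1 + (x ^ 2) ^ n * \<alpha> n 0 1"
    by (simp add: P_eq_\<alpha> \<alpha>_0_1_Suc[of n] \<alpha>_0_0_Suc[of n] algebra_simps)
  also have "\<dots>
      = Sum_any (\<lambda>j. f 0 (Suc n) j + f 2 (Suc n) j + (x ^ 2) ^ n * f 0 n j)" (is "_ = Sum_any ?f")
    by (simp only: \<alpha>_eq Sum_any_right_distrib[OF fin] Sum_any.distrib fin fin' finite_add)
  also have "?f = (\<lambda>j::int.
      (- 1) powi j * (x ^ 2) powi (2 * j ^ 2) * (1 + (x ^ 2) powi j) * T1 (Suc n) (4 * j + 1) x
      + (- 1) powi j * (x ^ 2) powi (2 * j ^ 2 + int n) * T1 n (4 * j + 1) x)"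
  proof
    fix j :: int
    have double: "(x ^ 2) powi m = x powi (2 * m)" for m
      by (simp add: power_int_power)
    moreover have "(x ^ 2) ^ n = x powi (2 * int n)"
      by (metis double power_int_of_nat)
    ultimately show "?f j = (- 1) powi j * (x ^ 2) powi (2 * j ^ 2) * (1 + (x ^ 2) powi j) * T1 (Suc n) (4 * j + 1) x
      + (- 1) powi j * (x ^ 2) powi (2 * j ^ 2 + int n) * T1 n (4 * j + 1) x"
      using nonzero by (simp add: f_def power_int_add algebra_simps)
  qed
  finally show ?thesis .
qed

end

section \<open>Rational functions in the square root of q\<close>

interpretation sqrt_q: square_root sqrt_q
proof
  show "sqrt_q \<noteq> 0"
    by (simp add: sqrt_q_def Zero_fract_def eq_fract)
  show "sqrt_q ^ n \<noteq> 1" if "0 < n" for n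
  proof
    \<comment> \<open>A power of the indeterminate vanishes at 0, whereas 1 does not.\<close>
    have "sqrt_q ^ n = Fract ([:0, 1:] ^ n) 1"
      by (induction n) (simp_all add: sqrt_q_def One_fract_def)
    moreover assume "sqrt_q ^ n = 1"
    ultimately have "[:0, 1:] ^ n = (1 :: rat poly)"
      by (simp add: One_fract_def eq_fract)
    then have "poly ([:0, 1:] ^ n) 0 = (1 :: rat)"
      by simp
    with that show False by (simp add: power_0_left)
  qed
qed

theorem mainTheorem4:
  shows "(\<forall>n\<ge>1. P ind_q n =
           Sum_any (\<lambda>j::int.
             (-1) powi j * ind_q powi (2 * j ^ 2) * (1 + ind_q powi j) * T1 n (4 * j + 1) sqrt_q
             + (-1) powi j * ind_q powi (2 * j ^ 2 + int n - 1) * T1 (n - 1) (4 * j + 1) sqrt_q))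
       \<and> P ind_q 0 = 1
       \<and> P ind_q 1 = 2
       \<and> (\<forall>n\<ge>2. P ind_q n =
           (1 + ind_q ^ (n - 1)) * P ind_q (n - 1) + ind_q ^ (n - 1) * P ind_q (n - 2))"
proof (intro conjI allI impI)
  fix n :: nat
  assume "1 \<le> n"
  then obtain m where n: "n = Suc m" by (cases n) auto
  show "P ind_q n =
           Sum_any (\<lambda>j::int.
             (-1) powi j * ind_q powi (2 * j ^ 2) * (1 + ind_q powi j) * T1 n (4 * j + 1) sqrt_q
             + (-1) powi j * ind_q powi (2 * j ^ 2 + int n - 1) * T1 (n - 1) (4 * j + 1) sqrt_q)"
    using sqrt_q.P_eq_Sum_any[of m] by (simp add: n ind_q_def)
next
  show "P ind_q 0 = 1" "P ind_q 1 = 2"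
    unfolding ind_q_def by (rule sqrt_q.sq.P_0 sqrt_q.sq.P_1)+
next
  fix n :: nat
  assume "2 \<le> n"
  then obtain m where "n = Suc (Suc m)"
    by (metis add_2_eq_Suc le_Suc_ex)
  then show "P ind_q n =
           (1 + ind_q ^ (n - 1)) * P ind_q (n - 1) + ind_q ^ (n - 1) * P ind_q (n - 2)"
    using sqrt_q.sq.P_recurrence[of m] by (simp add: ind_q_def algebra_simps)
qed

end
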